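(* There exist a language $L$ and an $L$ clause set $S(x)$ that is refutable by a clause set cycle such that $I\mathrm{Open}(L)\nvdash\neg S(x)$.
   Context: We work in many-sorted classical first-order logic; a language $L$ has finitely many sorts, among them a sort $\mathsf{nat}$, and contains function symbols $0:\mathsf{nat}$ and $s:\mathsf{nat}\to\mathsf{nat}$. For $k\in\mathbb{N}$, $\overline{k}=s^k0$. A literal is an atom or negated atom; an $L$ clause is a formula $\forall\vec y\,(l_1\vee\dots\vee l_k)$ with literals $l_i$; an $L$ clause set is a finite conjunction of $L$ clauses, here with only free variable $x$ of sort $\mathsf{nat}$. $\varphi\models\psi$ means every structure and variable assignment satisfying $\varphi$ satisfies $\psi$. A clause set $T(x)$ is a clause set cycle if $T(sx)\models T(x)$ and $T(0)\models\bot$. A clause set $R(x)$ is refutable by a clause set cycle if there are a clause set cycle $T(x)$ and $n\in\mathbb{N}$ with $R(s^nx)\models T(x)$ and $R(\overline{k})\models\bot$ for all $k<n$. For a formula $\psi(x,\vec z)$ with $x$ of sort $\mathsf{nat}$, $I_x\psi:=\forall\vec z\,(\psi(0,\vec z)\to\forall x(\psi(x,\vec z)\to\psi(sx,\vec z))\to\forall x\,\psi(x,\vec z))$, and $I\mathrm{Open}(L)$ is the set of all $I_x\psi$ with $\psi$ a quantifier-free $L$ formula and $x$ of sort $\mathsf{nat}$. $\nvdash\neg S(x)$ means the universal closure of $\neg S(x)$ is not derivable. *)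

theory Defs
  imports Main "HOL-Library.Countable_Set"
begin

section \<open>Many-sorted languages, terms and formulas\<close>

datatype sort = NatSort | Sort nat
datatype fsym = ZeroSym | SuccSym | FunSym nat
datatype psym = PredSym nat

text \<open>A variable is a name together with its sort.\<close>
type_synonym var = "nat \<times> sort"

datatype tm = Var var | Fun fsym "tm list"

datatype fm =
    Pred psym "tm list"
  | Eq tm tm
  | Bot
  | Imp fm fm
  | Conj fm fm
  | Disj fm fm
  | Forall var fm
  | Exists var fm

abbreviation Neg :: "fm \<Rightarrow> fm" where
  "Neg \<phi> \<equiv> Imp \<phi> Bot"

abbreviation Top :: fm where
  "Top \<equiv> Neg Bot"

record language =
  sorts :: "sort set"
  fun_type :: "fsym \<Rightarrow> (sort list \<times> sort) option"
  pred_type :: "psym \<Rightarrow> sort list option"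

definition is_language :: "language \<Rightarrow> bool" where
  "is_language L \<longleftrightarrow>
     finite (sorts L) \<and> NatSort \<in> sorts L \<and>
     (\<forall>f ss s. fun_type L f = Some (ss, s) \<longrightarrow> set ss \<subseteq> sorts L \<and> s \<in> sorts L) \<and>
     (\<forall>p ss. pred_type L p = Some ss \<longrightarrow> set ss \<subseteq> sorts L) \<and>
     fun_type L ZeroSym = Some ([], NatSort) \<and>
     fun_type L SuccSym = Some ([NatSort], NatSort)"

inductive has_sort :: "language \<Rightarrow> tm \<Rightarrow> sort \<Rightarrow> bool" for L where
  "snd v \<in> sorts L \<Longrightarrow> has_sort L (Var v) (snd v)"
| "fun_type L f = Some (ss, s) \<Longrightarrow> list_all2 (has_sort L) ts ss \<Longrightarrow> has_sort L (Fun f ts) s"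

primrec is_fm :: "language \<Rightarrow> fm \<Rightarrow> bool" where
  "is_fm L (Pred p ts) \<longleftrightarrow> (\<exists>ss. pred_type L p = Some ss \<and> list_all2 (has_sort L) ts ss)"
| "is_fm L (Eq t u) \<longleftrightarrow> (\<exists>s. has_sort L t s \<and> has_sort L u s)"
| "is_fm L Bot \<longleftrightarrow> True"
| "is_fm L (Imp \<phi> \<psi>) \<longleftrightarrow> is_fm L \<phi> \<and> is_fm L \<psi>"
| "is_fm L (Conj \<phi> \<psi>) \<longleftrightarrow> is_fm L \<phi> \<and> is_fm L \<psi>"
| "is_fm L (Disj \<phi> \<psi>) \<longleftrightarrow> is_fm L \<phi> \<and> is_fm L \<psi>"
| "is_fm L (Forall v \<phi>) \<longleftrightarrow> snd v \<in> sorts L \<and> is_fm L \<phi>"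
| "is_fm L (Exists v \<phi>) \<longleftrightarrow> snd v \<in> sorts L \<and> is_fm L \<phi>"

primrec quantifier_free :: "fm \<Rightarrow> bool" where
  "quantifier_free (Pred p ts) \<longleftrightarrow> True"
| "quantifier_free (Eq t u) \<longleftrightarrow> True"
| "quantifier_free Bot \<longleftrightarrow> True"
| "quantifier_free (Imp \<phi> \<psi>) \<longleftrightarrow> quantifier_free \<phi> \<and> quantifier_free \<psi>"
| "quantifier_free (Conj \<phi> \<psi>) \<longleftrightarrow> quantifier_free \<phi> \<and> quantifier_free \<psi>"
| "quantifier_free (Disj \<phi> \<psi>) \<longleftrightarrow> quantifier_free \<phi> \<and> quantifier_free \<psi>"
| "quantifier_free (Forall v \<phi>) \<longleftrightarrow> False"
| "quantifier_free (Exists v \<phi>) \<longleftrightarrow> False"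

primrec vars_tm :: "tm \<Rightarrow> var set" where
  "vars_tm (Var v) = {v}"
| "vars_tm (Fun f ts) = \<Union> (set (map vars_tm ts))"

primrec free_vars :: "fm \<Rightarrow> var set" where
  "free_vars (Pred p ts) = \<Union> (set (map vars_tm ts))"
| "free_vars (Eq t u) = vars_tm t \<union> vars_tm u"
| "free_vars Bot = {}"
| "free_vars (Imp \<phi> \<psi>) = free_vars \<phi> \<union> free_vars \<psi>"
| "free_vars (Conj \<phi> \<psi>) = free_vars \<phi> \<union> free_vars \<psi>"
| "free_vars (Disj \<phi> \<psi>) = free_vars \<phi> \<union> free_vars \<psi>"
| "free_vars (Forall v \<phi>) = free_vars \<phi> - {v}"
| "free_vars (Exists v \<phi>) = free_vars \<phi> - {v}"

primrec subst_tm :: "var \<Rightarrow> tm \<Rightarrow> tm \<Rightarrow> tm" where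
  "subst_tm x t (Var v) = (if v = x then t else Var v)"
| "subst_tm x t (Fun f us) = Fun f (map (subst_tm x t) us)"

text \<open>Replacement of the free occurrences of a variable. Bound variables are not renamed, so
  the result is the intended instance only if the term is free for the variable. This holds
  for all instances of clause sets and of quantifier-free formulas used below, where the term
  contains no variable other than the one being replaced.\<close>
primrec subst :: "var \<Rightarrow> tm \<Rightarrow> fm \<Rightarrow> fm" where
  "subst x t (Pred p ts) = Pred p (map (subst_tm x t) ts)"
| "subst x t (Eq u v) = Eq (subst_tm x t u) (subst_tm x t v)"
| "subst x t Bot = Bot"
| "subst x t (Imp \<phi> \<psi>) = Imp (subst x t \<phi>) (subst x t \<psi>)"
| "subst x t (Conj \<phi> \<psi>) = Conj (subst x t \<phi>) (subst x t \<psi>)"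
| "subst x t (Disj \<phi> \<psi>) = Disj (subst x t \<phi>) (subst x t \<psi>)"
| "subst x t (Forall v \<phi>) = Forall v (if v = x then \<phi> else subst x t \<phi>)"
| "subst x t (Exists v \<phi>) = Exists v (if v = x then \<phi> else subst x t \<phi>)"

primrec free_for :: "var \<Rightarrow> tm \<Rightarrow> fm \<Rightarrow> bool" where
  "free_for x t (Pred p ts) \<longleftrightarrow> True"
| "free_for x t (Eq u v) \<longleftrightarrow> True"
| "free_for x t Bot \<longleftrightarrow> True"
| "free_for x t (Imp \<phi> \<psi>) \<longleftrightarrow> free_for x t \<phi> \<and> free_for x t \<psi>"
| "free_for x t (Conj \<phi> \<psi>) \<longleftrightarrow> free_for x t \<phi> \<and> free_for x t \<psi>"
| "free_for x t (Disj \<phi> \<psi>) \<longleftrightarrow> free_for x t \<phi> \<and> free_for x t \<psi>"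
| "free_for x t (Forall v \<phi>) \<longleftrightarrow>
     x \<notin> free_vars (Forall v \<phi>) \<or> v \<notin> vars_tm t \<and> free_for x t \<phi>"
| "free_for x t (Exists v \<phi>) \<longleftrightarrow>
     x \<notin> free_vars (Exists v \<phi>) \<or> v \<notin> vars_tm t \<and> free_for x t \<phi>"

abbreviation zero :: tm where
  "zero \<equiv> Fun ZeroSym []"

abbreviation succ :: "tm \<Rightarrow> tm" where
  "succ t \<equiv> Fun SuccSym [t]"

primrec foralls :: "var list \<Rightarrow> fm \<Rightarrow> fm" where
  "foralls [] \<phi> = \<phi>"
| "foralls (v # vs) \<phi> = Forall v (foralls vs \<phi>)"

fun disjs :: "fm list \<Rightarrow> fm" where
  "disjs [] = Bot"
| "disjs [\<phi>] = \<phi>"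
| "disjs (\<phi> # \<psi> # \<phi>s) = Disj \<phi> (disjs (\<psi> # \<phi>s))"

fun conjs :: "fm list \<Rightarrow> fm" where
  "conjs [] = Top"
| "conjs [\<phi>] = \<phi>"
| "conjs (\<phi> # \<psi> # \<phi>s) = Conj \<phi> (conjs (\<psi> # \<phi>s))"


section \<open>Structures and semantic consequence\<close>

record 'u struct =
  carrier :: "sort \<Rightarrow> 'u set"
  fun_int :: "fsym \<Rightarrow> 'u list \<Rightarrow> 'u"
  pred_int :: "psym \<Rightarrow> 'u list \<Rightarrow> bool"

definition is_struct :: "language \<Rightarrow> 'u struct \<Rightarrow> bool" where
  "is_struct L M \<longleftrightarrow>
     (\<forall>s \<in> sorts L. carrier M s \<noteq> {}) \<and>
     (\<forall>f ss s as. fun_type L f = Some (ss, s) \<longrightarrow>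
        list_all2 (\<lambda>a s. a \<in> carrier M s) as ss \<longrightarrow> fun_int M f as \<in> carrier M s)"

definition is_assignment :: "language \<Rightarrow> 'u struct \<Rightarrow> (var \<Rightarrow> 'u) \<Rightarrow> bool" where
  "is_assignment L M \<rho> \<longleftrightarrow> (\<forall>v. snd v \<in> sorts L \<longrightarrow> \<rho> v \<in> carrier M (snd v))"

primrec value_tm :: "'u struct \<Rightarrow> (var \<Rightarrow> 'u) \<Rightarrow> tm \<Rightarrow> 'u" where
  "value_tm M \<rho> (Var v) = \<rho> v"
| "value_tm M \<rho> (Fun f ts) = fun_int M f (map (value_tm M \<rho>) ts)"

primrec satisfies :: "'u struct \<Rightarrow> (var \<Rightarrow> 'u) \<Rightarrow> fm \<Rightarrow> bool" where
  "satisfies M \<rho> (Pred p ts) \<longleftrightarrow> pred_int M p (map (value_tm M \<rho>) ts)"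
| "satisfies M \<rho> (Eq t u) \<longleftrightarrow> value_tm M \<rho> t = value_tm M \<rho> u"
| "satisfies M \<rho> Bot \<longleftrightarrow> False"
| "satisfies M \<rho> (Imp \<phi> \<psi>) \<longleftrightarrow> (satisfies M \<rho> \<phi> \<longrightarrow> satisfies M \<rho> \<psi>)"
| "satisfies M \<rho> (Conj \<phi> \<psi>) \<longleftrightarrow> satisfies M \<rho> \<phi> \<and> satisfies M \<rho> \<psi>"
| "satisfies M \<rho> (Disj \<phi> \<psi>) \<longleftrightarrow> satisfies M \<rho> \<phi> \<or> satisfies M \<rho> \<psi>"
| "satisfies M \<rho> (Forall v \<phi>) \<longleftrightarrow> (\<forall>a \<in> carrier M (snd v). satisfies M (\<rho>(v := a)) \<phi>)"
| "satisfies M \<rho> (Exists v \<phi>) \<longleftrightarrow> (\<exists>a \<in> carrier M (snd v). satisfies M (\<rho>(v := a)) \<phi>)"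

text \<open>HOL cannot quantify over the type of elements inside a definition, so the structures
  below have their carriers in the natural numbers. Since there are only countably many symbols
  this is no restriction: by the downward Loewenheim-Skolem theorem, consequence in this sense
  implies consequence over structures with elements of any type, see the theorem
  entails_any_type below.\<close>
definition entails :: "language \<Rightarrow> fm \<Rightarrow> fm \<Rightarrow> bool" where
  "entails L \<phi> \<psi> \<longleftrightarrow>
     (\<forall>(M :: nat struct) \<rho>. is_struct L M \<longrightarrow> is_assignment L M \<rho> \<longrightarrow>
        satisfies M \<rho> \<phi> \<longrightarrow> satisfies M \<rho> \<psi>)"

instance sort :: countable by countable_datatype
instance fsym :: countable by countable_datatype
instance psym :: countable by countable_datatype
instance tm :: countable by countable_datatype
instance fm :: countable by countable_datatype

text \<open>Names for the elements of the Skolem hull of a structure.\<close>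
datatype hull = HBase var | HFun fsym "hull list" | HWit fm var "hull list"
instance hull :: countable by countable_datatype

definition list_asg :: "(var \<Rightarrow> 'u) \<Rightarrow> 'u list \<Rightarrow> var \<Rightarrow> 'u" where
  "list_asg \<rho> as v = (if to_nat v < length as then as ! to_nat v else \<rho> v)"

definition witness :: "'u struct \<Rightarrow> (var \<Rightarrow> 'u) \<Rightarrow> fm \<Rightarrow> var \<Rightarrow> 'u list \<Rightarrow> 'u" where
  "witness M \<rho> \<phi> v as =
     (SOME a. a \<in> carrier M (snd v) \<and> satisfies M ((list_asg \<rho> as)(v := a)) \<phi>)"

primrec hull_val :: "'u struct \<Rightarrow> (var \<Rightarrow> 'u) \<Rightarrow> hull \<Rightarrow> 'u" where
  "hull_val M \<rho> (HBase v) = \<rho> v"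
| "hull_val M \<rho> (HFun f hs) = fun_int M f (map (hull_val M \<rho>) hs)"
| "hull_val M \<rho> (HWit \<phi> v hs) = witness M \<rho> \<phi> v (map (hull_val M \<rho>) hs)"

lemma finite_vars_tm: "finite (vars_tm t)"
  by (induction t) auto

lemma finite_free_vars: "finite (free_vars \<phi>)"
  by (induction \<phi>) (auto simp: finite_vars_tm)

lemma value_tm_cong: "(\<And>v. v \<in> vars_tm t \<Longrightarrow> \<rho> v = \<rho>' v) \<Longrightarrow> value_tm M \<rho> t = value_tm M \<rho>' t"
proof (induction t)
  case (Fun f ts)
  have "map (value_tm M \<rho>) ts = map (value_tm M \<rho>') ts"
    using Fun by (auto intro!: Fun.IH)
  then show ?case by (simp only: value_tm.simps)
qed simp

lemma satisfies_cong:
  "(\<And>v. v \<in> free_vars \<phi> \<Longrightarrow> \<rho> v = \<rho>' v) \<Longrightarrow> satisfies M \<rho> \<phi> = satisfies M \<rho>' \<phi>"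
proof (induction \<phi> arbitrary: \<rho> \<rho>')
  case (Pred p ts)
  have "map (value_tm M \<rho>) ts = map (value_tm M \<rho>') ts"
    using Pred by (auto intro!: value_tm_cong)
  then show ?case by (simp only: satisfies.simps)
next
  case (Eq t u)
  then have "value_tm M \<rho> t = value_tm M \<rho>' t" "value_tm M \<rho> u = value_tm M \<rho>' u"
    by (auto intro!: value_tm_cong)
  then show ?case by simp
next
  case (Imp \<phi> \<psi>)
  have "satisfies M \<rho> \<phi> = satisfies M \<rho>' \<phi>" "satisfies M \<rho> \<psi> = satisfies M \<rho>' \<psi>"
    using Imp.prems by (auto intro!: Imp.IH)
  then show ?case by simp
next
  case (Conj \<phi> \<psi>)
  have "satisfies M \<rho> \<phi> = satisfies M \<rho>' \<phi>" "satisfies M \<rho> \<psi> = satisfies M \<rho>' \<psi>"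
    using Conj.prems by (auto intro!: Conj.IH)
  then show ?case by simp
next
  case (Disj \<phi> \<psi>)
  have "satisfies M \<rho> \<phi> = satisfies M \<rho>' \<phi>" "satisfies M \<rho> \<psi> = satisfies M \<rho>' \<psi>"
    using Disj.prems by (auto intro!: Disj.IH)
  then show ?case by simp
next
  case (Forall v \<phi>)
  have "satisfies M (\<rho>(v := a)) \<phi> = satisfies M (\<rho>'(v := a)) \<phi>" for a
    using Forall.prems by (intro Forall.IH) auto
  then show ?case by simp
next
  case (Exists v \<phi>)
  have "satisfies M (\<rho>(v := a)) \<phi> = satisfies M (\<rho>'(v := a)) \<phi>" for a
    using Exists.prems by (intro Exists.IH) auto
  then show ?case by simp
qed simp

lemma hull_witness:
  assumes \<beta>: "\<And>w. \<beta> w \<in> range (hull_val M \<rho>)"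
    and ex: "\<exists>a \<in> carrier M (snd v). satisfies M (\<beta>(v := a)) \<phi>"
  shows "\<exists>a \<in> carrier M (snd v) \<inter> range (hull_val M \<rho>). satisfies M (\<beta>(v := a)) \<phi>"
proof -
  from \<beta> have "\<forall>w. \<exists>h. \<beta> w = hull_val M \<rho> h" by (simp add: image_iff)
  from choice[OF this] obtain h where h: "\<And>w. \<beta> w = hull_val M \<rho> (h w)" by (elim exE) blast
  have "finite (to_nat ` free_vars \<phi>)" by (simp add: finite_free_vars)
  then obtain N where "\<forall>n \<in> to_nat ` free_vars \<phi>. n < N"
    unfolding finite_nat_set_iff_bounded by (elim exE)
  then have N: "\<And>w. w \<in> free_vars \<phi> \<Longrightarrow> to_nat w < N" by blast
  define hs where "hs = map (\<lambda>n. h (from_nat n)) [0..<N]"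
  define as where "as = map (hull_val M \<rho>) hs"
  have as: "list_asg \<rho> as w = \<beta> w" if "w \<in> free_vars \<phi>" for w
    using N[OF that] by (simp add: list_asg_def as_def hs_def h)
  have eq: "satisfies M ((list_asg \<rho> as)(v := a)) \<phi> = satisfies M (\<beta>(v := a)) \<phi>" for a
    by (intro satisfies_cong) (simp add: as)
  define b where "b = witness M \<rho> \<phi> v as"
  have "\<exists>a. a \<in> carrier M (snd v) \<and> satisfies M ((list_asg \<rho> as)(v := a)) \<phi>"
    using ex unfolding eq by blast
  then have "b \<in> carrier M (snd v) \<and> satisfies M ((list_asg \<rho> as)(v := b)) \<phi>"
    unfolding b_def witness_def by (rule someI_ex)
  moreover have "b = hull_val M \<rho> (HWit \<phi> v hs)"
    by (simp only: b_def as_def hull_val.simps)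
  ultimately show ?thesis using eq by blast
qed

theorem entails_any_type:
  fixes M :: "'u struct"
  assumes "entails L \<phi> \<psi>" "is_struct L M" "is_assignment L M \<rho>" "satisfies M \<rho> \<phi>"
  shows "satisfies M \<rho> \<psi>"
proof -
  define H where "H = range (hull_val M \<rho>)"
  define g where "g = to_nat_on H"
  define g' where "g' = from_nat_into H"
  have count: "countable H" unfolding H_def by simp
  have g'g: "g' (g a) = a" if "a \<in> H" for a
    unfolding g_def g'_def using that count by simp
  define N :: "nat struct" where
    "N = \<lparr>carrier = (\<lambda>s. g ` (carrier M s \<inter> H)),
          fun_int = (\<lambda>f ns. g (fun_int M f (map g' ns))),
          pred_int = (\<lambda>p ns. pred_int M p (map g' ns))\<rparr>"
  have N_car: "carrier N s = g ` (carrier M s \<inter> H)" for s by (simp add: N_def)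
  have N_fun: "fun_int N f ns = g (fun_int M f (map g' ns))" for f ns by (simp add: N_def)
  have N_pred: "pred_int N p ns = pred_int M p (map g' ns)" for p ns by (simp add: N_def)
  have H_fun: "fun_int M f as \<in> H" if as: "set as \<subseteq> H" for f as
  proof -
    have "\<exists>hs. as = map (hull_val M \<rho>) hs"
      using as unfolding H_def ex_map_conv by auto
    then obtain hs where "as = map (hull_val M \<rho>) hs" by blast
    then have "fun_int M f as = hull_val M \<rho> (HFun f hs)" by simp
    then show ?thesis unfolding H_def by blast
  qed
  have val_H: "value_tm M \<beta> t \<in> H" if "\<And>w. \<beta> w \<in> H" for \<beta> t
    by (induction t) (auto intro!: H_fun simp: that)
  have val: "value_tm N (\<lambda>w. g (\<beta> w)) t = g (value_tm M \<beta> t)" if \<beta>: "\<And>w. \<beta> w \<in> H" for \<beta> t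
  proof (induction t)
    case (Fun f ts)
    have "map g' (map (value_tm N (\<lambda>w. g (\<beta> w))) ts) = map (value_tm M \<beta>) ts"
      using Fun by (auto simp: g'g val_H[OF \<beta>])
    then show ?case by (simp only: value_tm.simps N_fun)
  qed simp
  have sat: "satisfies N (\<lambda>w. g (\<beta> w)) \<chi> = satisfies M \<beta> \<chi>" if "\<And>w. \<beta> w \<in> H" for \<beta> \<chi>
    using that
  proof (induction \<chi> arbitrary: \<beta>)
    case (Pred p ts)
    have "map g' (map (value_tm N (\<lambda>w. g (\<beta> w))) ts) = map (value_tm M \<beta>) ts"
      using Pred by (auto simp: val g'g val_H)
    then show ?case by (simp only: satisfies.simps N_pred)
  next
    case (Eq t u)
    then have "value_tm M \<beta> t \<in> H" "value_tm M \<beta> u \<in> H" by (auto intro: val_H)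
    then have "g (value_tm M \<beta> t) = g (value_tm M \<beta> u) \<longleftrightarrow> value_tm M \<beta> t = value_tm M \<beta> u"
      using g'g by metis
    then show ?case using Eq by (simp add: val)
  next
    case (Forall v \<chi>)
    have upd: "satisfies N ((\<lambda>w. g (\<beta> w))(v := g a)) \<chi> = satisfies M (\<beta>(v := a)) \<chi>"
      if "a \<in> H" for a
    proof -
      have eq: "(\<lambda>w. g (\<beta> w))(v := g a) = (\<lambda>w. g ((\<beta>(v := a)) w))"
        by (rule ext) simp
      show ?thesis unfolding eq by (rule Forall.IH) (simp add: Forall.prems that)
    qed
    have "satisfies N (\<lambda>w. g (\<beta> w)) (Forall v \<chi>)
        = (\<forall>a \<in> carrier M (snd v) \<inter> H. satisfies M (\<beta>(v := a)) \<chi>)"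
      using upd by (auto simp: N_car)
    moreover have "\<exists>a \<in> carrier M (snd v) \<inter> H. \<not> satisfies M (\<beta>(v := a)) \<chi>"
      if "\<exists>a \<in> carrier M (snd v). \<not> satisfies M (\<beta>(v := a)) \<chi>"
      using hull_witness[of \<beta> M \<rho> v "Neg \<chi>"] Forall.prems that unfolding H_def by simp
    ultimately show ?case by auto
  next
    case (Exists v \<chi>)
    have upd: "satisfies N ((\<lambda>w. g (\<beta> w))(v := g a)) \<chi> = satisfies M (\<beta>(v := a)) \<chi>"
      if "a \<in> H" for a
    proof -
      have eq: "(\<lambda>w. g (\<beta> w))(v := g a) = (\<lambda>w. g ((\<beta>(v := a)) w))"
        by (rule ext) simp
      show ?thesis unfolding eq by (rule Exists.IH) (simp add: Exists.prems that)
    qed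
    have "satisfies N (\<lambda>w. g (\<beta> w)) (Exists v \<chi>)
        = (\<exists>a \<in> carrier M (snd v) \<inter> H. satisfies M (\<beta>(v := a)) \<chi>)"
      using upd by (auto simp: N_car)
    moreover have "\<exists>a \<in> carrier M (snd v) \<inter> H. satisfies M (\<beta>(v := a)) \<chi>"
      if "\<exists>a \<in> carrier M (snd v). satisfies M (\<beta>(v := a)) \<chi>"
      using hull_witness[of \<beta> M \<rho> v \<chi>] Exists.prems that unfolding H_def by simp
    ultimately show ?case by auto
  qed simp_all
  have \<rho>H: "\<rho> w \<in> H" for w
    unfolding H_def by (metis hull_val.simps(1) rangeI)
  have "is_struct L N"
    unfolding is_struct_def
  proof (intro conjI allI impI ballI)
    fix s assume "s \<in> sorts L"
    then have "\<rho> (0, s) \<in> carrier M s \<inter> H"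
      using assms(3) \<rho>H unfolding is_assignment_def by auto
    then show "carrier N s \<noteq> {}" unfolding N_car by blast
  next
    fix f ss s ns
    assume f: "fun_type L f = Some (ss, s)"
      and ns: "list_all2 (\<lambda>a s. a \<in> carrier N s) ns ss"
    have *: "list_all2 (\<lambda>a s. a \<in> carrier M s) (map g' ns) ss \<and> set (map g' ns) \<subseteq> H"
      using ns by (induction rule: list_all2_induct) (auto simp: N_car g'g)
    then have "fun_int M f (map g' ns) \<in> carrier M s"
      using assms(2) f unfolding is_struct_def by blast
    moreover have "fun_int M f (map g' ns) \<in> H" using * H_fun by blast
    ultimately show "fun_int N f ns \<in> carrier N s" by (simp add: N_car N_fun)
  qed
  moreover have "is_assignment L N (\<lambda>w. g (\<rho> w))"
    using assms(3) \<rho>H unfolding is_assignment_def N_car by auto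
  ultimately show ?thesis
    using assms(1,4) sat[of \<rho>] \<rho>H unfolding entails_def by blast
qed


section \<open>Derivability\<close>

text \<open>Natural deduction for classical many-sorted first-order logic with equality. Every
  derived formula is an L formula.\<close>
inductive derives :: "language \<Rightarrow> fm set \<Rightarrow> fm \<Rightarrow> bool" for L where
  Assm: "\<phi> \<in> \<Gamma> \<Longrightarrow> is_fm L \<phi> \<Longrightarrow> derives L \<Gamma> \<phi>"
| Weak: "derives L \<Gamma> \<phi> \<Longrightarrow> \<Gamma> \<subseteq> \<Delta> \<Longrightarrow> derives L \<Delta> \<phi>"
| RAA: "is_fm L \<phi> \<Longrightarrow> derives L (insert (Neg \<phi>) \<Gamma>) Bot \<Longrightarrow> derives L \<Gamma> \<phi>"
| ImpI: "is_fm L \<phi> \<Longrightarrow> derives L (insert \<phi> \<Gamma>) \<psi> \<Longrightarrow> derives L \<Gamma> (Imp \<phi> \<psi>)"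
| ImpE: "derives L \<Gamma> (Imp \<phi> \<psi>) \<Longrightarrow> derives L \<Gamma> \<phi> \<Longrightarrow> derives L \<Gamma> \<psi>"
| ConjI: "derives L \<Gamma> \<phi> \<Longrightarrow> derives L \<Gamma> \<psi> \<Longrightarrow> derives L \<Gamma> (Conj \<phi> \<psi>)"
| ConjE1: "derives L \<Gamma> (Conj \<phi> \<psi>) \<Longrightarrow> derives L \<Gamma> \<phi>"
| ConjE2: "derives L \<Gamma> (Conj \<phi> \<psi>) \<Longrightarrow> derives L \<Gamma> \<psi>"
| DisjI1: "is_fm L \<psi> \<Longrightarrow> derives L \<Gamma> \<phi> \<Longrightarrow> derives L \<Gamma> (Disj \<phi> \<psi>)"
| DisjI2: "is_fm L \<phi> \<Longrightarrow> derives L \<Gamma> \<psi> \<Longrightarrow> derives L \<Gamma> (Disj \<phi> \<psi>)"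
| DisjE: "derives L \<Gamma> (Disj \<phi> \<psi>) \<Longrightarrow> derives L (insert \<phi> \<Gamma>) \<chi> \<Longrightarrow> derives L (insert \<psi> \<Gamma>) \<chi> \<Longrightarrow>
    derives L \<Gamma> \<chi>"
| ForallI: "snd v \<in> sorts L \<Longrightarrow> v \<notin> \<Union> (free_vars ` \<Gamma>) \<Longrightarrow> derives L \<Gamma> \<phi> \<Longrightarrow>
    derives L \<Gamma> (Forall v \<phi>)"
| ForallE: "derives L \<Gamma> (Forall v \<phi>) \<Longrightarrow> has_sort L t (snd v) \<Longrightarrow> free_for v t \<phi> \<Longrightarrow>
    derives L \<Gamma> (subst v t \<phi>)"
| ExistsI: "is_fm L (Exists v \<phi>) \<Longrightarrow> has_sort L t (snd v) \<Longrightarrow> free_for v t \<phi> \<Longrightarrow>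
    derives L \<Gamma> (subst v t \<phi>) \<Longrightarrow> derives L \<Gamma> (Exists v \<phi>)"
| ExistsE: "derives L \<Gamma> (Exists v \<phi>) \<Longrightarrow> v \<notin> \<Union> (free_vars ` \<Gamma>) \<Longrightarrow> v \<notin> free_vars \<psi> \<Longrightarrow>
    derives L (insert \<phi> \<Gamma>) \<psi> \<Longrightarrow> derives L \<Gamma> \<psi>"
| EqI: "has_sort L t s \<Longrightarrow> derives L \<Gamma> (Eq t t)"
| EqE: "is_fm L \<phi> \<Longrightarrow> has_sort L t (snd v) \<Longrightarrow> has_sort L u (snd v) \<Longrightarrow>
    free_for v t \<phi> \<Longrightarrow> free_for v u \<phi> \<Longrightarrow>
    derives L \<Gamma> (Eq t u) \<Longrightarrow> derives L \<Gamma> (subst v t \<phi>) \<Longrightarrow> derives L \<Gamma> (subst v u \<phi>)"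


section \<open>Clause sets, clause set cycles and open induction\<close>

definition is_literal :: "language \<Rightarrow> fm \<Rightarrow> bool" where
  "is_literal L l \<longleftrightarrow> is_fm L l \<and>
     (\<exists>A. ((\<exists>p ts. A = Pred p ts) \<or> (\<exists>t u. A = Eq t u)) \<and> (l = A \<or> l = Neg A))"

definition is_clause :: "language \<Rightarrow> fm \<Rightarrow> bool" where
  "is_clause L C \<longleftrightarrow>
     (\<exists>ys ls. (\<forall>y \<in> set ys. snd y \<in> sorts L) \<and> (\<forall>l \<in> set ls. is_literal L l) \<and>
        C = foralls ys (disjs ls))"

definition is_clause_set :: "language \<Rightarrow> var \<Rightarrow> fm \<Rightarrow> bool" where
  "is_clause_set L x R \<longleftrightarrow>
     (\<exists>Cs. (\<forall>C \<in> set Cs. is_clause L C) \<and> R = conjs Cs) \<and> free_vars R \<subseteq> {x}"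

definition clause_set_cycle :: "language \<Rightarrow> var \<Rightarrow> fm \<Rightarrow> bool" where
  "clause_set_cycle L x T \<longleftrightarrow> is_clause_set L x T \<and>
     entails L (subst x (succ (Var x)) T) T \<and> entails L (subst x zero T) Bot"

definition refutable_by_clause_set_cycle :: "language \<Rightarrow> var \<Rightarrow> fm \<Rightarrow> bool" where
  "refutable_by_clause_set_cycle L x R \<longleftrightarrow>
     (\<exists>T n. clause_set_cycle L x T \<and>
        entails L (subst x ((succ ^^ n) (Var x)) R) T \<and>
        (\<forall>k<n. entails L (subst x ((succ ^^ k) zero) R) Bot))"

definition induction_axiom :: "var \<Rightarrow> var list \<Rightarrow> fm \<Rightarrow> fm" where
  "induction_axiom x zs \<psi> =
     foralls zs (Imp (subst x zero \<psi>)
       (Imp (Forall x (Imp \<psi> (subst x (succ (Var x)) \<psi>))) (Forall x \<psi>)))"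

definition IOpen :: "language \<Rightarrow> fm set" where
  "IOpen L = {induction_axiom x zs \<psi> | x zs \<psi>.
     snd x = NatSort \<and> is_fm L \<psi> \<and> quantifier_free \<psi> \<and>
     distinct zs \<and> x \<notin> set zs \<and> (\<forall>z \<in> set zs. snd z \<in> sorts L) \<and>
     free_vars \<psi> \<subseteq> insert x (set zs)}"

end

theory Submission
  imports Defs
begin

text \<open>Let \<open>g\<close> map a second sort, carrying a constant \<open>c\<close> and a unary function \<open>f\<close>, to
  \<open>nat\<close>, and let \<open>S(x)\<close> say that \<open>g c = 0\<close>, \<open>g (f y) = s (g y)\<close> and \<open>g y \<noteq> x\<close> for all \<open>y\<close>. As the
  range of \<open>g\<close> contains \<open>0\<close> and is closed under \<open>s\<close>, this is a clause set cycle. Interpret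
  \<open>nat\<close> by the natural numbers followed by a copy of the integers, and \<open>g\<close> as the inclusion of
  the natural numbers: then \<open>S\<close> holds at every nonstandard element. No term of the second sort
  contains a variable of sort \<open>nat\<close>, so an atom compares two values that are constant or of
  the form \<open>s\<^sup>k x\<close>, and a quantifier-free formula with parameters defines a finite or cofinite
  set of values of \<open>x\<close>. Such a set satisfies induction, because a cofinite set contains elements
  arbitrarily far to the left in the copy of the integers.\<close>

section \<open>Soundness of natural deduction\<close>

lemma value_subst_tm: "value_tm M \<rho> (subst_tm x t u) = value_tm M (\<rho>(x := value_tm M \<rho> t)) u"
proof (induction u)
  case (Fun f us)
  have "map (value_tm M \<rho> \<circ> subst_tm x t) us = map (value_tm M (\<rho>(x := value_tm M \<rho> t))) us"
    by (intro map_cong refl) (simp only: comp_apply Fun.IH)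
  then show ?case by (simp only: subst_tm.simps value_tm.simps map_map)
qed simp

lemma subst_tm_fresh: "x \<notin> vars_tm u \<Longrightarrow> subst_tm x t u = u"
  by (induction u) (auto intro!: map_idI)

lemma subst_fresh: "x \<notin> free_vars \<phi> \<Longrightarrow> subst x t \<phi> = \<phi>"
  by (induction \<phi>) (auto intro!: map_idI simp: subst_tm_fresh)

text \<open>If \<open>x\<close> is free in the quantified formula, the bound variable differs from
  \<open>x\<close> and does not occur in \<open>t\<close>, so the two updates commute and
  \<open>t\<close> keeps its value. Otherwise substitution changes nothing.\<close>

lemma satisfies_subst:
  "free_for x t \<phi> \<Longrightarrow> satisfies M \<rho> (subst x t \<phi>) = satisfies M (\<rho>(x := value_tm M \<rho> t)) \<phi>"
proof (induction \<phi> arbitrary: \<rho>)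
  case (Pred p ts)
  have "map (value_tm M \<rho> \<circ> subst_tm x t) ts = map (value_tm M (\<rho>(x := value_tm M \<rho> t))) ts"
    by (intro map_cong refl) (simp only: comp_apply value_subst_tm)
  then show ?case by (simp only: subst.simps satisfies.simps map_map)
next
  case (Forall v \<phi>)
  show ?case
  proof (cases "x \<in> free_vars (Forall v \<phi>)")
    case True
    with Forall.prems have "v \<notin> vars_tm t" "free_for x t \<phi>" "v \<noteq> x" by auto
    moreover have "value_tm M (\<rho>(v := a)) t = value_tm M \<rho> t" for a
      using \<open>v \<notin> vars_tm t\<close> by (intro value_tm_cong) auto
    ultimately show ?thesis using Forall.IH by (simp add: fun_upd_twist del: fun_upd_apply)
  next
    case False
    then have "satisfies M (\<rho>(x := value_tm M \<rho> t)) (Forall v \<phi>) = satisfies M \<rho> (Forall v \<phi>)"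
      by (intro satisfies_cong) auto
    then show ?thesis by (simp only: subst_fresh[OF False])
  qed
next
  case (Exists v \<phi>)
  show ?case
  proof (cases "x \<in> free_vars (Exists v \<phi>)")
    case True
    with Exists.prems have "v \<notin> vars_tm t" "free_for x t \<phi>" "v \<noteq> x" by auto
    moreover have "value_tm M (\<rho>(v := a)) t = value_tm M \<rho> t" for a
      using \<open>v \<notin> vars_tm t\<close> by (intro value_tm_cong) auto
    ultimately show ?thesis using Exists.IH by (simp add: fun_upd_twist del: fun_upd_apply)
  next
    case False
    then have "satisfies M (\<rho>(x := value_tm M \<rho> t)) (Exists v \<phi>) = satisfies M \<rho> (Exists v \<phi>)"
      by (intro satisfies_cong) auto
    then show ?thesis by (simp only: subst_fresh[OF False])
  qed
qed (simp_all add: value_subst_tm)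

text \<open>For \<open>ForallE\<close> and \<open>ExistsI\<close>: the carrier over which the
  quantifier ranges must contain the value of the instantiating term.\<close>

lemma value_tm_in_carrier:
  assumes "is_struct L M" "is_assignment L M \<rho>" "has_sort L t s"
  shows "value_tm M \<rho> t \<in> carrier M s"
  using assms(3)
proof (induction rule: has_sort.induct)
  case (1 v)
  then show ?case using assms(2) unfolding is_assignment_def value_tm.simps by blast
next
  case (2 f ss s ts)
  have "list_all2 (\<lambda>a s. a \<in> carrier M s) (map (value_tm M \<rho>) ts) ss"
    using 2(2) by (auto simp: list_all2_conv_all_nth)
  then show ?case using 2(1) assms(1) unfolding is_struct_def value_tm.simps by blast
qed

lemma is_assignment_upd:
  "is_assignment L M \<rho> \<Longrightarrow> a \<in> carrier M (snd v) \<Longrightarrow> is_assignment L M (\<rho>(v := a))"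
  unfolding is_assignment_def by (metis fun_upd_apply)

lemma satisfies_upd_fresh:
  "v \<notin> \<Union> (free_vars ` \<Gamma>) \<Longrightarrow> \<forall>\<gamma> \<in> \<Gamma>. satisfies M \<rho> \<gamma> \<Longrightarrow> \<forall>\<gamma> \<in> \<Gamma>. satisfies M (\<rho>(v := a)) \<gamma>"
  by (metis UN_I fun_upd_other satisfies_cong)

text \<open>The element type is arbitrary, so this applies directly to a model on the rationals,
  although \<open>entails\<close> is defined with carriers in \<open>nat\<close>.\<close>

theorem derives_sound:
  assumes "derives L \<Gamma> \<phi>" "is_struct L M" "is_assignment L M \<rho>" "\<forall>\<gamma> \<in> \<Gamma>. satisfies M \<rho> \<gamma>"
  shows "satisfies M \<rho> \<phi>"
  using assms(1,3,4)
proof (induction arbitrary: \<rho> rule: derives.induct)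
  case (ForallI v \<Gamma> \<phi>)
  show ?case
    unfolding satisfies.simps
  proof
    fix a assume "a \<in> carrier M (snd v)"
    then show "satisfies M (\<rho>(v := a)) \<phi>"
      using ForallI is_assignment_upd satisfies_upd_fresh by metis
  qed
next
  case (ForallE \<Gamma> v \<phi> t)
  then have "\<forall>a \<in> carrier M (snd v). satisfies M (\<rho>(v := a)) \<phi>" by (metis satisfies.simps(7))
  moreover have "value_tm M \<rho> t \<in> carrier M (snd v)"
    using ForallE.hyps(2) ForallE.prems(1) by (intro value_tm_in_carrier[OF assms(2)])
  ultimately show ?case unfolding satisfies_subst[OF ForallE.hyps(3)] by blast
next
  case (ExistsI v \<phi> t \<Gamma>)
  then have "satisfies M (\<rho>(v := value_tm M \<rho> t)) \<phi>" by (metis satisfies_subst)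
  moreover have "value_tm M \<rho> t \<in> carrier M (snd v)"
    using ExistsI.hyps(2) ExistsI.prems(1) by (intro value_tm_in_carrier[OF assms(2)])
  ultimately show ?case unfolding satisfies.simps by blast
next
  case (ExistsE \<Gamma> v \<phi> \<psi>)
  then have "satisfies M \<rho> (Exists v \<phi>)" by blast
  then obtain a where a: "a \<in> carrier M (snd v)" "satisfies M (\<rho>(v := a)) \<phi>"
    unfolding satisfies.simps by blast
  have "satisfies M (\<rho>(v := a)) \<psi>"
    using is_assignment_upd[OF ExistsE.prems(1) a(1)] a(2)
      satisfies_upd_fresh[OF ExistsE.hyps(2) ExistsE.prems(2)]
    by (intro ExistsE.IH) blast+
  moreover have "satisfies M (\<rho>(v := a)) \<psi> = satisfies M \<rho> \<psi>"
    using ExistsE.hyps(3) by (intro satisfies_cong) auto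
  ultimately show ?case by simp
next
  case (EqE \<phi> t v u \<Gamma>)
  then have "satisfies M (\<rho>(v := value_tm M \<rho> t)) \<phi>" by (metis satisfies_subst)
  moreover have "value_tm M \<rho> t = value_tm M \<rho> u" using EqE by simp
  ultimately show ?case by (simp only: satisfies_subst[OF EqE.hyps(5)])
next
  case (Weak \<Gamma> \<phi> \<Delta>)
  then show ?case by blast
next
  case (RAA \<phi> \<Gamma>)
  then show ?case by (metis insertE satisfies.simps(3,4))
next
  case (ImpI \<phi> \<Gamma> \<psi>)
  then show ?case by (metis insertE satisfies.simps(4))
next
  case (DisjE \<Gamma> \<phi> \<psi> \<chi>)
  then show ?case by (metis insertE satisfies.simps(6))
qed simp_all

section \<open>Open induction axioms in a structure\<close>

lemma quantifier_free_free_for: "quantifier_free \<phi> \<Longrightarrow> free_for x t \<phi>"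
  by (induction \<phi>) auto

lemma satisfies_foralls:
  assumes "\<And>\<rho>. is_assignment L M \<rho> \<Longrightarrow> satisfies M \<rho> \<phi>" "is_assignment L M \<rho>"
  shows "satisfies M \<rho> (foralls vs \<phi>)"
  using assms(2) by (induction vs arbitrary: \<rho>) (auto simp: assms(1) is_assignment_upd)

text \<open>The parameters \<open>zs\<close> are absorbed by letting \<open>ind\<close> range over
  all assignments.\<close>

lemma satisfies_induction_axiom:
  assumes "quantifier_free \<psi>" "is_assignment L M \<rho>"
    and ind: "\<And>\<rho>. is_assignment L M \<rho> \<Longrightarrow> satisfies M (\<rho>(x := fun_int M ZeroSym [])) \<psi> \<Longrightarrow>
      (\<And>a. a \<in> carrier M (snd x) \<Longrightarrow> satisfies M (\<rho>(x := a)) \<psi> \<Longrightarrow>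
        satisfies M (\<rho>(x := fun_int M SuccSym [a])) \<psi>) \<Longrightarrow>
      \<forall>a \<in> carrier M (snd x). satisfies M (\<rho>(x := a)) \<psi>"
  shows "satisfies M \<rho> (induction_axiom x zs \<psi>)"
  unfolding induction_axiom_def
  using assms(2)
  by (rule satisfies_foralls[rotated])
    (use ind in \<open>simp add: satisfies_subst quantifier_free_free_for[OF assms(1)]\<close>)

section \<open>The language, the clause set and the model\<close>

text \<open>In the notation above, \<open>rsort\<close> is the second sort, \<open>cnst\<close> is
  \<open>c\<close>, \<open>step\<close> is \<open>f\<close> and \<open>rank\<close> is
  \<open>g\<close>.\<close>

abbreviation "rsort \<equiv> Sort 0"
abbreviation "cnst \<equiv> Fun (FunSym 0) []"
abbreviation "step t \<equiv> Fun (FunSym 1) [t]"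
abbreviation "rank t \<equiv> Fun (FunSym 2) [t]"

definition rank_lang :: language where
  "rank_lang = \<lparr>sorts = {NatSort, rsort},
     fun_type = (\<lambda>f. if f = ZeroSym then Some ([], NatSort)
       else if f = SuccSym then Some ([NatSort], NatSort)
       else if f = FunSym 0 then Some ([], rsort)
       else if f = FunSym 1 then Some ([rsort], rsort)
       else if f = FunSym 2 then Some ([rsort], NatSort)
       else None),
     pred_type = (\<lambda>_. None)\<rparr>"

abbreviation "xvar \<equiv> (0, NatSort) :: var"
abbreviation "yvar \<equiv> (0, rsort) :: var"

definition unranked :: fm where
  "unranked = conjs [Eq (rank cnst) zero,
     Forall yvar (Eq (rank (step (Var yvar))) (succ (rank (Var yvar)))),
     Forall yvar (Neg (Eq (rank (Var yvar)) (Var xvar)))]"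

text \<open>The half-integers are the copy of the integers.\<close>
definition half_model :: "rat struct" where
  "half_model = \<lparr>carrier = (\<lambda>s. if s = NatSort then \<nat> \<union> {q. q - 1/2 \<in> \<int>} else \<nat>),
     fun_int = (\<lambda>f as. if f = SuccSym \<or> f = FunSym 1 then hd as + 1
       else if f = FunSym 2 then hd as else 0),
     pred_int = (\<lambda>_ _. False)\<rparr>"

section \<open>Well-formedness of the language and the clause set\<close>

lemma is_language_rank_lang: "is_language rank_lang"
  by (auto simp: is_language_def rank_lang_def split: if_splits)

lemma has_sort_simps:
  "has_sort rank_lang (Var v) s \<longleftrightarrow> snd v \<in> {NatSort, rsort} \<and> s = snd v"
  "has_sort rank_lang zero s \<longleftrightarrow> s = NatSort"
  "has_sort rank_lang (succ t) s \<longleftrightarrow> has_sort rank_lang t NatSort \<and> s = NatSort"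
  "has_sort rank_lang cnst s \<longleftrightarrow> s = rsort"
  "has_sort rank_lang (step t) s \<longleftrightarrow> has_sort rank_lang t rsort \<and> s = rsort"
  "has_sort rank_lang (rank t) s \<longleftrightarrow> has_sort rank_lang t rsort \<and> s = NatSort"
  by (subst has_sort.simps; auto simp: rank_lang_def)+

lemma is_clause_set_unranked: "is_clause_set rank_lang xvar unranked"
proof -
  have lit: "is_literal rank_lang (Eq (rank cnst) zero)"
    "is_literal rank_lang (Eq (rank (step (Var yvar))) (succ (rank (Var yvar))))"
    "is_literal rank_lang (Neg (Eq (rank (Var yvar)) (Var xvar)))"
    unfolding is_literal_def by (fastforce simp: has_sort_simps simp del: One_nat_def)+
  have y: "snd yvar \<in> sorts rank_lang" by (simp add: rank_lang_def)
  have clause: "is_clause rank_lang (foralls ys l)"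
    if "is_literal rank_lang l" "\<forall>y \<in> set ys. snd y \<in> sorts rank_lang" for ys l
    unfolding is_clause_def using that by (intro exI[of _ ys] exI[of _ "[l]"]) simp
  have "\<exists>Cs. (\<forall>C \<in> set Cs. is_clause rank_lang C) \<and> unranked = conjs Cs"
    unfolding unranked_def
    \<comment> \<open>Closing the equation by \<open>refl\<close> instantiates the schematic list of
      clauses.\<close>
    by (rule exI, rule conjI[OF _ refl])
      (use clause[OF lit(1), of "[]"] clause[OF lit(2), of "[yvar]"] clause[OF lit(3), of "[yvar]"] y
        in simp)
  then show ?thesis by (auto simp: is_clause_set_def unranked_def)
qed

section \<open>Refutability by a clause set cycle\<close>

lemma clause_set_cycle_unranked: "clause_set_cycle rank_lang xvar unranked"
proof -
  have step: "fun_int M (FunSym 1) [a] \<in> carrier M rsort"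
    if "is_struct rank_lang M" "a \<in> carrier M rsort" for M :: "nat struct" and a
    using that unfolding is_struct_def by (auto simp: rank_lang_def)
  have cnst: "fun_int M (FunSym 0) [] \<in> carrier M rsort"
    if "is_struct rank_lang M" for M :: "nat struct"
    using that unfolding is_struct_def by (auto simp: rank_lang_def)
  have "entails rank_lang (subst xvar (succ (Var xvar)) unranked) unranked"
    unfolding entails_def
  proof (intro allI impI)
    fix M :: "nat struct" and \<rho>
    assume M: "is_struct rank_lang M"
      and "satisfies M \<rho> (subst xvar (succ (Var xvar)) unranked)"
    then have
      *: "fun_int M (FunSym 2) [fun_int M (FunSym 0) []] = fun_int M ZeroSym []"
      "\<forall>a \<in> carrier M rsort. fun_int M (FunSym 2) [fun_int M (FunSym 1) [a]]
        = fun_int M SuccSym [fun_int M (FunSym 2) [a]]"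
      "\<forall>a \<in> carrier M rsort. fun_int M (FunSym 2) [a] \<noteq> fun_int M SuccSym [\<rho> xvar]"
      by (simp_all add: unranked_def)
    \<comment> \<open>If \<open>a\<close> had rank \<open>x\<close>, then \<open>step a\<close>
      would have rank \<open>s x\<close>, which the third clause at \<open>s x\<close>
      forbids.\<close>
    have "\<forall>a \<in> carrier M rsort. fun_int M (FunSym 2) [a] \<noteq> \<rho> xvar"
      using *(2,3) step[OF M] by metis
    with *(1,2) show "satisfies M \<rho> unranked" by (simp add: unranked_def)
  qed
  moreover have "entails rank_lang (subst xvar zero unranked) Bot"
    unfolding entails_def
  proof (intro allI impI)
    fix M :: "nat struct" and \<rho>
    assume M: "is_struct rank_lang M" and "satisfies M \<rho> (subst xvar zero unranked)"
    \<comment> \<open>The constant has rank 0 and so violates the third clause at 0.\<close>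
    then show "satisfies M \<rho> Bot" using cnst[OF M] by (simp add: unranked_def) metis
  qed
  ultimately show ?thesis using is_clause_set_unranked by (simp add: clause_set_cycle_def)
qed

text \<open>The cycle is the clause set itself with n = 0, so no numeral has to be refuted.\<close>

lemma refutable_unranked: "refutable_by_clause_set_cycle rank_lang xvar unranked"
proof -
  have "entails rank_lang (subst xvar ((succ ^^ 0) (Var xvar)) unranked) unranked"
    by (simp add: entails_def unranked_def)
  then show ?thesis
    unfolding refutable_by_clause_set_cycle_def using clause_set_cycle_unranked by blast
qed

section \<open>Definable sets and induction in the model\<close>

lemma is_struct_half_model: "is_struct rank_lang half_model"
proof -
  have "q + 1 - 1/2 \<in> \<int>" if "q - 1/2 \<in> \<int>" for q :: rat
    using Ints_add[OF that Ints_1] by (simp add: algebra_simps)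
  moreover have "q + 1 \<in> \<nat>" if "q \<in> \<nat>" for q :: rat
    using Nats_add[OF that Nats_1] .
  ultimately show ?thesis
    by (auto simp: is_struct_def rank_lang_def half_model_def list_all2_Cons2 split: if_splits)
qed

text \<open>Only \<open>SuccSym\<close> takes an argument of sort \<open>nat\<close>, and it turns
  \<open>a + k\<close> into \<open>a + (k + 1)\<close>. The arguments of \<open>step\<close> and
  \<open>rank\<close> have sort \<open>rsort\<close>; recording the sort in the second alternative
  excludes it for them.\<close>

lemma value_half_model_cases:
  assumes "has_sort rank_lang t s" "snd x = NatSort"
  shows "(\<exists>b. \<forall>a. value_tm half_model (\<rho>(x := a)) t = b) \<or>
    s = NatSort \<and> (\<exists>k. \<forall>a. value_tm half_model (\<rho>(x := a)) t = a + k)"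
  using assms(1)
proof (induction rule: has_sort.induct)
  case (1 v)
  show ?case
  proof (cases "v = x")
    case True
    then show ?thesis using assms(2) by (intro disjI2 conjI exI[of _ 0]) auto
  qed auto
next
  case (2 f ss s ts)
  from 2(1) consider "f = ZeroSym \<or> f = FunSym 0" | "f = SuccSym" "ss = [NatSort]" "s = NatSort"
    | "f = FunSym 1" "ss = [rsort]" | "f = FunSym 2" "ss = [rsort]"
    by (auto simp: rank_lang_def split: if_splits)
  then show ?case
  proof cases
    case 2
    with \<open>list_all2 _ ts ss\<close> show ?thesis
      by (auto simp: half_model_def list_all2_Cons2 add.assoc)
  qed (use 2(2) in \<open>auto simp: half_model_def list_all2_Cons2\<close>)
qed

text \<open>An equation between values constant or of the form \<open>a + k\<close> holds for all
  \<open>a\<close>, for none or for exactly one, and the finite and cofinite sets are closed under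
  Boolean combinations.\<close>

lemma finite_or_cofinite:
  assumes "quantifier_free \<psi>" "is_fm rank_lang \<psi>" "snd x = NatSort"
  shows "finite {a. satisfies half_model (\<rho>(x := a)) \<psi>} \<or>
    finite {a. \<not> satisfies half_model (\<rho>(x := a)) \<psi>}"
  (is "finite {a. ?sat \<psi> a} \<or> _")
  using assms(1,2)
proof (induction \<psi>)
  case (Pred p ts)
  then show ?case by (simp add: rank_lang_def)
next
  case (Eq t u)
  then obtain s where s: "has_sort rank_lang t s" "has_sort rank_lang u s" by auto
  have *: "finite {a :: rat. a + k = b}" "finite {a :: rat. b = a + k}" for k b
    by (rule finite_subset[of _ "{b - k}"]; auto)+
  from value_half_model_cases[OF s(1) assms(3), of \<rho>] value_half_model_cases[OF s(2) assms(3), of \<rho>]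
  show ?case unfolding satisfies.simps by (elim disjE exE conjE) (simp_all only: *, simp_all)
next
  case (Imp \<phi> \<psi>)
  have "{a. ?sat (Imp \<phi> \<psi>) a} = {a. \<not> ?sat \<phi> a} \<union> {a. ?sat \<psi> a}"
    "{a. \<not> ?sat (Imp \<phi> \<psi>) a} = {a. ?sat \<phi> a} \<inter> {a. \<not> ?sat \<psi> a}" by auto
  with Imp show ?case by (auto simp del: fun_upd_apply satisfies.simps)
next
  case (Conj \<phi> \<psi>)
  have "{a. ?sat (Conj \<phi> \<psi>) a} = {a. ?sat \<phi> a} \<inter> {a. ?sat \<psi> a}"
    "{a. \<not> ?sat (Conj \<phi> \<psi>) a} = {a. \<not> ?sat \<phi> a} \<union> {a. \<not> ?sat \<psi> a}" by auto
  with Conj show ?case by (auto simp del: fun_upd_apply satisfies.simps)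
next
  case (Disj \<phi> \<psi>)
  have "{a. ?sat (Disj \<phi> \<psi>) a} = {a. ?sat \<phi> a} \<union> {a. ?sat \<psi> a}"
    "{a. \<not> ?sat (Disj \<phi> \<psi>) a} = {a. \<not> ?sat \<phi> a} \<inter> {a. \<not> ?sat \<psi> a}" by auto
  with Disj show ?case by (auto simp del: fun_upd_apply satisfies.simps)
qed auto

text \<open>The least counterexample to the conclusion would be nonstandard, but then its predecessor is
  a smaller one.\<close>
lemma finite_or_cofinite_induct:
  fixes P :: "rat \<Rightarrow> bool"
  assumes fin: "finite {a. P a} \<or> finite {a. \<not> P a}"
    and zero: "P 0"
    and step: "\<And>a. a \<in> \<nat> \<or> a - 1/2 \<in> \<int> \<Longrightarrow> P a \<Longrightarrow> P (a + 1)"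
    and a: "a \<in> \<nat> \<or> a - 1/2 \<in> \<int>"
  shows "P a"
proof (rule ccontr)
  assume "\<not> P a"
  have nat: "P (of_nat n)" for n
    by (induction n) (use zero step[OF disjI1[OF of_nat_in_Nats]] in \<open>auto simp: add.commute\<close>)
  \<comment> \<open>Truth at all standard numbers excludes the finite alternative of
    \<open>fin\<close>, so the counterexamples are finite in number and have a minimum.\<close>
  have "infinite (range (of_nat :: nat \<Rightarrow> rat))"
    by (simp add: finite_image_iff inj_on_def)
  then have "infinite {a. P a}"
    using nat by (metis finite_subset image_subsetI mem_Collect_eq)
  define B where "B = {a. (a \<in> \<nat> \<or> a - 1/2 \<in> \<int>) \<and> \<not> P a}"
  have "finite B" using fin \<open>infinite {a. P a}\<close> by (auto simp: B_def intro: finite_subset[rotated])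
  moreover have "a \<in> B" using a \<open>\<not> P a\<close> by (simp add: B_def)
  ultimately have "Min B \<in> B" "\<forall>b \<in> B. Min B \<le> b" by (auto intro: Min_in)
  then have "Min B \<notin> \<nat>" using nat by (auto simp: B_def elim!: Nats_cases)
  then have "Min B - 1/2 - 1 \<in> \<int>" using \<open>Min B \<in> B\<close> by (intro Ints_diff[OF _ Ints_1]) (auto simp: B_def)
  then have "(Min B - 1) - 1/2 \<in> \<int>" by (simp add: algebra_simps)
  \<comment> \<open>By \<open>step\<close>, truth at the predecessor would carry over to
    \<open>Min B\<close>.\<close>
  moreover from this have "\<not> P (Min B - 1)" using step[of "Min B - 1"] \<open>Min B \<in> B\<close> by (auto simp: B_def)
  ultimately have "Min B - 1 \<in> B" by (simp add: B_def)
  with \<open>\<forall>b \<in> B. Min B \<le> b\<close> show False by force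
qed

text \<open>Once the assignment fixes the parameters, the premises of the axiom become those of
  \<open>finite_or_cofinite_induct\<close>.\<close>

lemma half_model_IOpen:
  assumes "\<phi> \<in> IOpen rank_lang" "is_assignment rank_lang half_model \<rho>"
  shows "satisfies half_model \<rho> \<phi>"
proof -
  from assms(1) obtain x zs \<psi> where \<phi>: "\<phi> = induction_axiom x zs \<psi>"
    and \<psi>: "quantifier_free \<psi>" "is_fm rank_lang \<psi>" "snd x = NatSort"
    by (auto simp: IOpen_def)
  have M: "fun_int half_model ZeroSym [] = 0" "\<And>a. fun_int half_model SuccSym [a] = a + 1"
    "\<And>a. a \<in> carrier half_model (snd x) \<longleftrightarrow> a \<in> \<nat> \<or> a - 1/2 \<in> \<int>"
    by (simp_all add: half_model_def \<psi>(3))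
  show ?thesis unfolding \<phi>
  proof (rule satisfies_induction_axiom[OF \<psi>(1) assms(2)], unfold M, intro ballI)
    fix \<beta> a
    assume "satisfies half_model (\<beta>(x := 0)) \<psi>"
      and "\<And>a. a \<in> \<nat> \<or> a - 1/2 \<in> \<int> \<Longrightarrow> satisfies half_model (\<beta>(x := a)) \<psi> \<Longrightarrow>
        satisfies half_model (\<beta>(x := a + 1)) \<psi>"
      and "a \<in> carrier half_model (snd x)"
    then show "satisfies half_model (\<beta>(x := a)) \<psi>"
      using finite_or_cofinite_induct[OF finite_or_cofinite[OF \<psi>], of \<beta> a] unfolding M by blast
  qed
qed

section \<open>Non-derivability of the negated clause set\<close>

lemma half_model_unranked: "satisfies half_model (\<rho>(xvar := 1/2)) unranked"
proof -
  \<comment> \<open>This is the third clause at the nonstandard element 1/2, cleared of the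
    denominator; it holds by parity.\<close>
  have "a * 2 \<noteq> 1" if "a \<in> \<nat>" for a :: rat
  proof
    assume "a * 2 = 1"
    moreover obtain n where "a = of_nat n" using \<open>a \<in> \<nat>\<close> by (rule Nats_cases)
    ultimately have "of_nat (2 * n) = (of_nat 1 :: rat)" by simp
    then have "2 * n = 1" by (simp only: of_nat_eq_iff)
    then show False by presburger
  qed
  then show ?thesis by (auto simp: unranked_def half_model_def)
qed

lemma not_derives_unranked: "\<not> derives rank_lang (IOpen rank_lang) (Forall xvar (Neg unranked))"
proof
  assume der: "derives rank_lang (IOpen rank_lang) (Forall xvar (Neg unranked))"
  \<comment> \<open>The value 0 lies in the carriers of both sorts.\<close>
  have asg: "is_assignment rank_lang half_model (\<lambda>_. 0)"
    by (simp add: is_assignment_def half_model_def)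
  have "satisfies half_model (\<lambda>_. 0) (Forall xvar (Neg unranked))"
    using derives_sound[OF der is_struct_half_model asg] half_model_IOpen[OF _ asg] by blast
  moreover have "1/2 \<in> carrier half_model NatSort" by (simp add: half_model_def)
  ultimately show False using half_model_unranked[of "\<lambda>_. 0"] by (metis satisfies.simps(3,4,7) snd_conv)
qed

theorem theorem4p6:
  "\<exists>(L :: language) (x :: var) (S :: fm).
     is_language L \<and> snd x = NatSort \<and> is_clause_set L x S \<and>
     refutable_by_clause_set_cycle L x S \<and>
     \<not> derives L (IOpen L) (Forall x (Neg S))"
  using is_language_rank_lang is_clause_set_unranked refutable_unranked not_derives_unranked
  by (intro exI[of _ rank_lang] exI[of _ xvar] exI[of _ unranked]) simp

end
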